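(* Let $A=RB:I\to\mathbb{R}^{3\times6}$ be smooth on an open interval $I$, with columns linearly independent over $\mathbb{R}$ (as functions on $I$), where $R(t)\in SO(3)$ and $$B=\begin{pmatrix}\ell_1b_{12}&b_{12}&b_{13}&\ell_2b_{15}&b_{15}&\ell_1b_{15}+b_{13}/\ell_2\\0&0&b_{23}&\ell_2b_{25}&b_{25}&\ell_1b_{25}+b_{23}/\ell_2\\0&0&-1/(b_{12}b_{25})&0&0&-1/(\ell_2b_{12}b_{25})\end{pmatrix},$$ with $b_{12},b_{25},\ell_2$ nowhere zero. Suppose that $Q_{12},Q_{13},Q_{14},Q_{25},Q_{23},Q_{24},Q_{35},Q_{36},Q_{45},Q_{46},Q_{56}$ and $Q_{15}-Q_{26}$ are constant, and that in the relation $\ell_1=k_2\ell_2+k_1+k_0/\ell_2$ (with real constants $k_0,k_1,k_2$) we have $k_2=0$, i.e. $\ell_1=k_1+k_0/\ell_2$. Then $R$ is constant and $$\ell_1=k_1+\frac{k_0t^3}{k_4},\qquad \ell_2=\frac{k_4}{t^3},\qquad b_{15}=k_6t^2,\qquad b_{25}=k_5t^2,$$ $$b_{12}=\frac{k_3}{t},\qquad b_{13}=-k_0k_6t^2+\frac{k_7}{t},\qquad b_{23}=-k_0k_5t^2+\frac{k_8}{t},$$ where the $k_j$ are constants.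
   Context: For $A(t)\in\mathbb{R}^{3\times m}$ with columns $A_i$, $Q_{ij}=\langle A_i',A_j\rangle-\langle A_j',A_i\rangle$, $'=d/dt$. Origin: $\varphi(z,t)=A(t)v(z)$ is sought as a solution of the 3D incompressible Euler equations in Lagrangian form with $v=(z_1,z_2,z_3,f_1(z_3),z_2f_3'(z_1)+f_2(z_1),f_3(z_1))$ (parabolic case, $m=6$). The form of $B$ corresponds to the determinant conditions $p_{123}=p_{356}=p_{135}-p_{236}=p_{124}=p_{456}=p_{245}=0$, $p_{235}=p_{145}-p_{246}=1$, $p_{125}=p_{345}=0$, where $p_{ijk}=\det(A_i,A_j,A_k)$; here $A_1=\ell_1A_2$, $A_4=\ell_2A_5$, $A_6=A_3/\ell_2+\ell_1A_5$. It is derived from these constraints on $A$ that there is no rotational component ($R$ is constant) and that nontrivial solutions satisfy $\ell_1=k_2\ell_2+k_1+k_0/\ell_2$ for constants $k_0,k_1,k_2$; the present statement is the case $k_2=0$. Solutions with columns of $A$ linearly dependent over $\mathbb{R}$ are called reducible and discarded.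
   Formalization: The formulas are proved up to a translation of time (t replaced by t - t0, with t0 outside I), since the hypotheses are translation invariant; R is assumed continuous, since otherwise signs of R and of the first two rows of B could be flipped at single times. *)

theory Defs
  imports "HOL-Analysis.Analysis"
begin

(* The iterated derivatives are two-sided: meant for open I only. *)
definition smooth_on_open :: "real set \<Rightarrow> (real \<Rightarrow> 'a::real_normed_vector) \<Rightarrow> bool" where
  "smooth_on_open I f \<longleftrightarrow>
     (\<forall>n. \<forall>t\<in>I. (((\<lambda>g s. vector_derivative g (at s)) ^^ n) f) differentiable (at t))"

definition Q :: "(real \<Rightarrow> real^'m^'n) \<Rightarrow> 'm \<Rightarrow> 'm \<Rightarrow> real \<Rightarrow> real" where
  "Q A i j t =
     vector_derivative (\<lambda>s. column i (A s)) (at t) \<bullet> column j (A t)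
     - vector_derivative (\<lambda>s. column j (A s)) (at t) \<bullet> column i (A t)"

(* Independence of the columns as an indexed family of functions on I (constant coefficients);
   at a single time t the columns may well be linearly dependent. *)
definition columns_independent_on :: "real set \<Rightarrow> (real \<Rightarrow> real^'m^'n) \<Rightarrow> bool" where
  "columns_independent_on I A \<longleftrightarrow>
     (\<forall>c :: 'm \<Rightarrow> real.
        (\<forall>t\<in>I. (\<Sum>j\<in>UNIV. c j *\<^sub>R column j (A t)) = 0) \<longrightarrow> (\<forall>j. c j = 0))"

(* The columns satisfy B1 = l1 B2, B4 = l2 B5, B6 = B3 / l2 + l1 B5, and the third row
   normalises det (B2, B3, B5) = 1.
   In the index type 6 the numeral 6 equals 0, so the six columns are indexed by 1, ..., 6. *)
definition B_mat ::
  "real \<Rightarrow> real \<Rightarrow> real \<Rightarrow> real \<Rightarrow> real \<Rightarrow> real \<Rightarrow> real \<Rightarrow> real^6^3" where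
  "B_mat l1 l2 b12 b13 b15 b23 b25 = vector
     [vector [l1 * b12, b12, b13, l2 * b15, b15, l1 * b15 + b13 / l2],
      vector [0, 0, b23, l2 * b25, b25, l1 * b25 + b23 / l2],
      vector [0, 0, - 1 / (b12 * b25), 0, 0, - 1 / (l2 * b12 * b25)]]"

end

theory Submission
  imports Defs
begin

text \<open>
  The entry \<open>Q A i j\<close> is the Wronskian \<open>f' \<bullet> g - g' \<bullet> f\<close> of the columns \<open>f = A\<^sub>i\<close>, \<open>g = A\<^sub>j\<close>.
  Put \<open>u = 1 / \<ell>\<^sub>2\<close> and \<open>x = A\<^sub>2\<close>, \<open>y = A\<^sub>3 + k\<^sub>0 A\<^sub>5\<close>, \<open>z = A\<^sub>4\<close>. Because \<open>\<ell>\<^sub>1 = k\<^sub>1 + k\<^sub>0 u\<close>, the six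
  columns of \<open>A\<close> are
    \<open>(k\<^sub>1 + k\<^sub>0 u) x\<close>, \<open>x\<close>, \<open>y - k\<^sub>0 u z\<close>, \<open>z\<close>, \<open>u z\<close>, \<open>u y + k\<^sub>1 u z\<close>:
  apart from the vectors \<open>x, y, z\<close> only the one scalar function \<open>u\<close> occurs. Linear independence of the
  columns says in particular that \<open>u\<close> is not constant (columns 4 and 5) and that \<open>k\<^sub>0 \<noteq> 0\<close> (columns 1
  and 2).

  In these terms, the constancy of the Wronskians separates: since \<open>u\<close> takes at least two values,
  the coefficient of \<open>u\<close> in each relation must vanish, and what remains is that \<open>x, y, z\<close> have pairwise
  Wronskian zero and that \<open>u'\<close> times their Gram matrix is constant (\<open>pencil_relations\<close>).

  On the other hand \<open>det (x, y, z) = 1 / u\<close>, so the Gram determinant turns this into the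
  differential equation \<open>u'\<^sup>3 = K u\<^sup>2\<close>. Hence the cube root of \<open>u\<close> is an affine function \<open>v = \<kappa> (t - t\<^sub>0)\<close>,
  and \<open>u' = 3 \<kappa> v\<^sup>2\<close>. The frame \<open>v x, v y, v z\<close> therefore has a constant Gram matrix, and its
  Wronskians still vanish. A constant Gram matrix makes the matrix of products \<open>f' \<bullet> g\<close>
  skew, vanishing Wronskians make it symmetric; so all derivatives are zero and the frame does
  not move (\<open>frame_constant\<close>, \<open>frame_from_pencil\<close>). This determines the columns of \<open>A\<close>.

  It remains to read off \<open>R\<close> and the entries of \<open>B\<close>. The columns of \<open>A\<close> have known directions, so
  the triangular shape of \<open>B\<close> fixes the columns of \<open>R\<close> up to sign, and continuity of \<open>R\<close> on an interval
  fixes the signs (\<open>triangular_factorization_constant\<close>).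
\<close>

section \<open>Wronskians of vector-valued functions\<close>

definition wronskian :: "(real \<Rightarrow> 'a::real_inner) \<Rightarrow> (real \<Rightarrow> 'a) \<Rightarrow> real \<Rightarrow> real" where
  "wronskian f g t = vector_derivative f (at t) \<bullet> g t - vector_derivative g (at t) \<bullet> f t"

lemma wronskian_swap: "wronskian g f t = - wronskian f g t"
  by (simp add: wronskian_def)

lemma wronskian_self [simp]: "wronskian f f t = 0"
  by (simp add: wronskian_def)

lemma wronskian_cong:
  assumes "open I" "t \<in> I" "\<And>s. s \<in> I \<Longrightarrow> f s = f' s" "\<And>s. s \<in> I \<Longrightarrow> g s = g' s"
  shows "wronskian f g t = wronskian f' g' t"
proof -
  have ev: "\<forall>\<^sub>F s in nhds t. f s = f' s" "\<forall>\<^sub>F s in nhds t. g s = g' s"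
    using assms eventually_nhds by blast+
  have "vector_derivative f (at t) = vector_derivative f' (at t)"
    "vector_derivative g (at t) = vector_derivative g' (at t)"
    using ev by (auto intro!: vector_derivative_cong_eq)
  then show ?thesis using assms by (simp add: wronskian_def)
qed

lemma wronskian_scale_left:
  assumes "f differentiable (at t)" "(\<phi> has_real_derivative d) (at t)"
  shows "wronskian (\<lambda>s. \<phi> s *\<^sub>R f s) g t = \<phi> t * wronskian f g t + d * (f t \<bullet> g t)"
proof -
  have "((\<lambda>s. \<phi> s *\<^sub>R f s) has_vector_derivative
      \<phi> t *\<^sub>R vector_derivative f (at t) + d *\<^sub>R f t) (at t)"
    using assms by (intro has_vector_derivative_scaleR) (auto simp: vector_derivative_works)
  from vector_derivative_at[OF this] show ?thesis
    by (simp add: wronskian_def inner_left_distrib algebra_simps inner_commute)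
qed

lemma wronskian_scale_right:
  assumes "g differentiable (at t)" "(\<phi> has_real_derivative d) (at t)"
  shows "wronskian f (\<lambda>s. \<phi> s *\<^sub>R g s) t = \<phi> t * wronskian f g t - d * (f t \<bullet> g t)"
  using wronskian_scale_left[OF assms, of f]
  by (simp add: wronskian_swap[of f] inner_commute)

lemma wronskian_add_right:
  assumes "f differentiable (at t)" "g differentiable (at t)"
  shows "wronskian h (\<lambda>s. f s + g s) t = wronskian h f t + wronskian h g t"
  using assms by (simp add: wronskian_def vector_derivative_add_at inner_add_left inner_add_right)

lemma wronskian_diff_left:
  assumes "f differentiable (at t)" "g differentiable (at t)"
  shows "wronskian (\<lambda>s. f s - g s) h t = wronskian f h t - wronskian g h t"
  using assms by (simp add: wronskian_def vector_derivative_diff_at inner_diff_left inner_diff_right)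

lemma wronskian_diff_right:
  assumes "f differentiable (at t)" "g differentiable (at t)"
  shows "wronskian h (\<lambda>s. f s - g s) t = wronskian h f t - wronskian h g t"
  using assms by (simp add: wronskian_def vector_derivative_diff_at inner_diff_left inner_diff_right)

section \<open>Separation of the Wronskian relations\<close>

lemma linear_coefficient_zero:
  fixes a b :: real
  assumes "\<not> u constant_on I" "\<And>t. t \<in> I \<Longrightarrow> a * u t = b"
  shows "a = 0"
proof (rule ccontr)
  assume "a \<noteq> 0"
  then have "u t = b / a" if "t \<in> I" for t
    using assms(2)[OF that] by (simp add: field_simps)
  then show False using assms(1) by (auto simp: constant_on_def)
qed

text \<open>
  The functions \<open>a1, x, a3, z, a5, a6\<close> are the six columns. Each Wronskian expands into terms
  \<open>wronskian f g\<close> and \<open>u' * (f \<bullet> g)\<close> with \<open>f, g\<close> among \<open>x, y, z\<close>, with coefficients polynomial in \<open>u\<close>.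
  For the pairs \<open>x, z\<close> and \<open>x, y\<close> the Wronskian is a constant, and two relations contain it
  together with the inner product in independent combinations. Eliminating the inner product leaves
  a relation that is affine in \<open>u\<close>, whose linear coefficient is a nonzero multiple of the Wronskian.
  For the pair \<open>y, z\<close> the elimination only makes \<open>u * wronskian y z\<close> constant; columns 5 and 6 make
  \<open>u\<^sup>2 * wronskian y z\<close> constant as well, and both can be constant only if they are zero.
\<close>

lemma pencil_relations:
  fixes x y z :: "real \<Rightarrow> 'a::real_inner" and u u' :: "real \<Rightarrow> real" and k0 k1 :: real
  defines "a1 \<equiv> \<lambda>t. (k1 + k0 * u t) *\<^sub>R x t"
    and "a3 \<equiv> \<lambda>t. y t - (k0 * u t) *\<^sub>R z t"
    and "a5 \<equiv> \<lambda>t. u t *\<^sub>R z t"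
    and "a6 \<equiv> \<lambda>t. u t *\<^sub>R y t + (k1 * u t) *\<^sub>R z t"
  assumes diff: "\<And>t. t \<in> I \<Longrightarrow> x differentiable (at t)"
      "\<And>t. t \<in> I \<Longrightarrow> y differentiable (at t)" "\<And>t. t \<in> I \<Longrightarrow> z differentiable (at t)"
    and u: "\<And>t. t \<in> I \<Longrightarrow> (u has_real_derivative u' t) (at t)"
    and unz: "\<And>t. t \<in> I \<Longrightarrow> u t \<noteq> 0"
    and nonconst: "\<not> u constant_on I" and k0: "k0 \<noteq> 0"
    and const: "wronskian a1 x constant_on I" "wronskian a1 a3 constant_on I"
      "wronskian a1 z constant_on I" "wronskian x a5 constant_on I"
      "wronskian x a3 constant_on I" "wronskian x z constant_on I"
      "wronskian a3 a5 constant_on I" "wronskian a3 a6 constant_on I"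
      "wronskian z a5 constant_on I" "wronskian z a6 constant_on I"
      "wronskian a5 a6 constant_on I"
      "(\<lambda>t. wronskian a1 a5 t - wronskian x a6 t) constant_on I"
  shows "\<And>t. t \<in> I \<Longrightarrow> wronskian x y t = 0"
    and "\<And>t. t \<in> I \<Longrightarrow> wronskian x z t = 0"
    and "\<And>t. t \<in> I \<Longrightarrow> wronskian y z t = 0"
    and "(\<lambda>t. u' t * (x t \<bullet> x t)) constant_on I" "(\<lambda>t. u' t * (x t \<bullet> y t)) constant_on I"
    and "(\<lambda>t. u' t * (x t \<bullet> z t)) constant_on I" "(\<lambda>t. u' t * (y t \<bullet> y t)) constant_on I"
    and "(\<lambda>t. u' t * (y t \<bullet> z t)) constant_on I" "(\<lambda>t. u' t * (z t \<bullet> z t)) constant_on I"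
proof -
  have expand:
    "wronskian a1 x t = k0 * (u' t * (x t \<bullet> x t))"
    "wronskian a1 a3 t = (k1 + k0 * u t) * (wronskian x y t - k0 * (u t * wronskian x z t - u' t * (x t \<bullet> z t)))
       + k0 * (u' t * (x t \<bullet> y t)) - k0\<^sup>2 * u t * (u' t * (x t \<bullet> z t))"
    "wronskian a1 z t = (k1 + k0 * u t) * wronskian x z t + k0 * (u' t * (x t \<bullet> z t))"
    "wronskian a1 a5 t = (k1 + k0 * u t) * (u t * wronskian x z t - u' t * (x t \<bullet> z t))
       + k0 * u t * (u' t * (x t \<bullet> z t))"
    "wronskian x a3 t = wronskian x y t - k0 * (u t * wronskian x z t - u' t * (x t \<bullet> z t))"
    "wronskian x a5 t = u t * wronskian x z t - u' t * (x t \<bullet> z t)"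
    "wronskian x a6 t = u t * wronskian x y t - u' t * (x t \<bullet> y t)
       + k1 * (u t * wronskian x z t - u' t * (x t \<bullet> z t))"
    "wronskian a3 a5 t = u t * wronskian y z t - u' t * (y t \<bullet> z t)"
    "wronskian a3 a6 t = - (u' t * (y t \<bullet> y t)) + k1 * (u t * wronskian y z t - u' t * (y t \<bullet> z t))
       + k0 * (u t * (u t * wronskian y z t))"
    "wronskian z a5 t = - (u' t * (z t \<bullet> z t))"
    "wronskian z a6 t = - (u t * wronskian y z t) - u' t * (y t \<bullet> z t) - k1 * (u' t * (z t \<bullet> z t))"
    "wronskian a5 a6 t = - (u t * (u t * wronskian y z t))"
    if "t \<in> I" for t
  proof -
    note [simp] = diff[OF that]
    have d: "((\<lambda>t. k1 + k0 * u t) has_real_derivative k0 * u' t) (at t)"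
      "((\<lambda>t. k0 * u t) has_real_derivative k0 * u' t) (at t)"
      "((\<lambda>t. k1 * u t) has_real_derivative k1 * u' t) (at t)"
      by (auto intro!: derivative_eq_intros u[OF that])
    note d' = d u[OF that]
    have du: "u differentiable (at t)"
      using u[OF that] by (auto simp: real_differentiable_def)
    have [simp]: "(\<lambda>t. (k0 * u t) *\<^sub>R z t) differentiable (at t)"
      "(\<lambda>t. u t *\<^sub>R y t) differentiable (at t)"
      "(\<lambda>t. (k1 * u t) *\<^sub>R z t) differentiable (at t)"
      using du by (auto intro!: differentiable_scaleR)
    note sl = d'[THEN wronskian_scale_left[rotated]]
    note sr = d'[THEN wronskian_scale_right[rotated]]
    note [simp] = sl sr wronskian_add_right
       wronskian_diff_left wronskian_diff_right wronskian_swap[of y x]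
       wronskian_swap[of z x] wronskian_swap[of z y]
    show "wronskian a1 x t = k0 * (u' t * (x t \<bullet> x t))"
      unfolding a1_def by simp
    show "wronskian a1 z t = (k1 + k0 * u t) * wronskian x z t + k0 * (u' t * (x t \<bullet> z t))"
      unfolding a1_def by simp
    show "wronskian z a5 t = - (u' t * (z t \<bullet> z t))"
      unfolding a5_def by simp
    show "wronskian x a5 t = u t * wronskian x z t - u' t * (x t \<bullet> z t)"
      unfolding a5_def by simp
    show "wronskian a1 a3 t = (k1 + k0 * u t) * (wronskian x y t - k0 * (u t * wronskian x z t - u' t * (x t \<bullet> z t)))
       + k0 * (u' t * (x t \<bullet> y t)) - k0\<^sup>2 * u t * (u' t * (x t \<bullet> z t))"
      unfolding a1_def a3_def by (simp add: inner_commute inner_add_right inner_diff_right; simp add: algebra_simps power2_eq_square)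
    show "wronskian a1 a5 t = (k1 + k0 * u t) * (u t * wronskian x z t - u' t * (x t \<bullet> z t))
       + k0 * u t * (u' t * (x t \<bullet> z t))"
      unfolding a1_def a5_def by (simp add: inner_commute; simp add: algebra_simps power2_eq_square)
    show "wronskian x a3 t = wronskian x y t - k0 * (u t * wronskian x z t - u' t * (x t \<bullet> z t))"
      unfolding a3_def by (simp add: inner_commute; simp add: algebra_simps power2_eq_square)
    show "wronskian x a6 t = u t * wronskian x y t - u' t * (x t \<bullet> y t)
       + k1 * (u t * wronskian x z t - u' t * (x t \<bullet> z t))"
      unfolding a6_def by (simp add: inner_commute; simp add: algebra_simps power2_eq_square)
    show "wronskian a3 a5 t = u t * wronskian y z t - u' t * (y t \<bullet> z t)"
      unfolding a3_def a5_def by (simp add: inner_commute inner_diff_left; simp add: algebra_simps power2_eq_square)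
    show "wronskian a3 a6 t = - (u' t * (y t \<bullet> y t)) + k1 * (u t * wronskian y z t - u' t * (y t \<bullet> z t))
       + k0 * (u t * (u t * wronskian y z t))"
      unfolding a3_def a6_def
      by (simp add: inner_commute inner_diff_left inner_add_right inner_diff_right; simp add: algebra_simps power2_eq_square)
    show "wronskian z a6 t = - (u t * wronskian y z t) - u' t * (y t \<bullet> z t) - k1 * (u' t * (z t \<bullet> z t))"
      unfolding a6_def by (simp add: inner_commute; simp add: algebra_simps power2_eq_square)
    show "wronskian a5 a6 t = - (u t * (u t * wronskian y z t))"
      unfolding a5_def a6_def
      by (simp add: inner_commute inner_diff_left inner_add_right inner_diff_right; simp add: algebra_simps power2_eq_square)
  qed
  obtain c12 where c12: "\<And>t. t \<in> I \<Longrightarrow> wronskian a1 x t = c12"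
    using const(1) unfolding constant_on_def by blast
  obtain c13 where c13: "\<And>t. t \<in> I \<Longrightarrow> wronskian a1 a3 t = c13"
    using const(2) unfolding constant_on_def by blast
  obtain c14 where c14: "\<And>t. t \<in> I \<Longrightarrow> wronskian a1 z t = c14"
    using const(3) unfolding constant_on_def by blast
  obtain c25 where c25: "\<And>t. t \<in> I \<Longrightarrow> wronskian x a5 t = c25"
    using const(4) unfolding constant_on_def by blast
  obtain c23 where c23: "\<And>t. t \<in> I \<Longrightarrow> wronskian x a3 t = c23"
    using const(5) unfolding constant_on_def by blast
  obtain c24 where c24: "\<And>t. t \<in> I \<Longrightarrow> wronskian x z t = c24"
    using const(6) unfolding constant_on_def by blast
  obtain c35 where c35: "\<And>t. t \<in> I \<Longrightarrow> wronskian a3 a5 t = c35"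
    using const(7) unfolding constant_on_def by blast
  obtain c36 where c36: "\<And>t. t \<in> I \<Longrightarrow> wronskian a3 a6 t = c36"
    using const(8) unfolding constant_on_def by blast
  obtain c45 where c45: "\<And>t. t \<in> I \<Longrightarrow> wronskian z a5 t = c45"
    using const(9) unfolding constant_on_def by blast
  obtain c46 where c46: "\<And>t. t \<in> I \<Longrightarrow> wronskian z a6 t = c46"
    using const(10) unfolding constant_on_def by blast
  obtain c56 where c56: "\<And>t. t \<in> I \<Longrightarrow> wronskian a5 a6 t = c56"
    using const(11) unfolding constant_on_def by blast
  obtain c where c: "\<And>t. t \<in> I \<Longrightarrow> wronskian a1 a5 t - wronskian x a6 t = c"
    using const(12) unfolding constant_on_def by blast
  \<comment> \<open>Columns 2 and 5 give the inner product, which is then substituted into columns 1 and 4.\<close>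
  have "2 * k0 * c24 * u t = c14 - k1 * c24 + k0 * c25" if "t \<in> I" for t
  proof -
    have "u' t * (x t \<bullet> z t) = u t * c24 - c25"
      using expand(6)[OF that] c24[OF that] c25[OF that] by simp
    then have "c14 = (k1 + k0 * u t) * c24 + k0 * (u t * c24 - c25)"
      using expand(3)[OF that] c14[OF that] c24[OF that] by simp
    then show ?thesis by (simp add: algebra_simps)
  qed
  from linear_coefficient_zero[OF nonconst this] have c24_0: "c24 = 0" using k0 by simp
  then show xz: "wronskian x z t = 0" if "t \<in> I" for t using c24[OF that] c24_0 by simp
  have xz': "u' t * (x t \<bullet> z t) = - c25" if "t \<in> I" for t
    using expand(6)[OF that] c25[OF that] xz[OF that] by simp
  then show "(\<lambda>t. u' t * (x t \<bullet> z t)) constant_on I" by (auto simp: constant_on_def)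
  \<comment> \<open>For \<open>x, y\<close> the two independent combinations come from columns 1 and 3 and from the difference
    of columns 1, 5 and columns 2, 6.\<close>
  have wxy: "wronskian x y t = c23 + k0 * c25" if "t \<in> I" for t
    using expand(5)[OF that] c23[OF that] xz[OF that] xz'[OF that] by simp
  have xy1: "k0 * (u t * (c23 + k0 * c25) + u' t * (x t \<bullet> y t)) = c13 - k1 * c23" if "t \<in> I" for t
    using expand(2)[OF that, unfolded c13[OF that] xz[OF that] xz'[OF that] wxy[OF that]]
    by (simp add: algebra_simps power2_eq_square)
  have xy2: "u t * (c23 + k0 * c25) - u' t * (x t \<bullet> y t) = - c" if "t \<in> I" for t
    using c[OF that, unfolded expand(4,7)[OF that] xz[OF that] xz'[OF that] wxy[OF that]]
    by (simp add: algebra_simps)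
  have "(2 * k0 * (c23 + k0 * c25)) * u t = c13 - k1 * c23 - k0 * c" if "t \<in> I" for t
    using xy1[OF that] arg_cong[OF xy2[OF that], of "\<lambda>w. k0 * w"] by (simp add: algebra_simps)
  from linear_coefficient_zero[OF nonconst this] have cxy: "c23 + k0 * c25 = 0" using k0 by simp
  then show "wronskian x y t = 0" if "t \<in> I" for t using wxy[OF that] by simp
  show "(\<lambda>t. u' t * (x t \<bullet> y t)) constant_on I"
    using xy2 unfolding cxy by (auto simp: constant_on_def)
  \<comment> \<open>For \<open>y, z\<close> the two combinations come from columns 3, 5 and from columns 4, 6; the latter also
    contain \<open>z \<bullet> z\<close>.\<close>
  have zz: "u' t * (z t \<bullet> z t) = - c45" if "t \<in> I" for t
    using expand(10)[OF that] c45[OF that] by simp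
  then show "(\<lambda>t. u' t * (z t \<bullet> z t)) constant_on I" by (auto simp: constant_on_def)
  have wyz: "2 * (u t * wronskian y z t) = c35 - c46 + k1 * c45" if "t \<in> I" for t
    using expand(8,11)[OF that] c35[OF that] c46[OF that] zz[OF that] by (simp add: algebra_simps)
  have "(c35 - c46 + k1 * c45) * u t = - 2 * c56" if "t \<in> I" for t
    using expand(12)[OF that] c56[OF that] arg_cong[OF wyz[OF that], of "\<lambda>w. u t * w"] by (simp add: algebra_simps)
  from linear_coefficient_zero[OF nonconst this] have cyz: "c35 - c46 + k1 * c45 = 0" .
  have uyz: "u t * wronskian y z t = 0" if "t \<in> I" for t
    using wyz[OF that] cyz by simp
  show "wronskian y z t = 0" if "t \<in> I" for t
    using uyz[OF that] unz[OF that] by simp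
  have yz: "u' t * (y t \<bullet> z t) = - c35" if "t \<in> I" for t
    using expand(8)[OF that] c35[OF that] uyz[OF that] by simp
  then show "(\<lambda>t. u' t * (y t \<bullet> z t)) constant_on I" by (auto simp: constant_on_def)
  have "u' t * (y t \<bullet> y t) = k1 * c35 - c36" if "t \<in> I" for t
    using expand(9)[OF that] c36[OF that] uyz[OF that] yz[OF that] by simp
  then show "(\<lambda>t. u' t * (y t \<bullet> y t)) constant_on I" by (auto simp: constant_on_def)
  show "(\<lambda>t. u' t * (x t \<bullet> x t)) constant_on I"
    using expand(1) c12 k0 unfolding constant_on_def by (metis nonzero_mult_div_cancel_left)
qed

section \<open>Rigidity of the frame\<close>

text \<open>
  For members \<open>f, g\<close> of the family, \<open>f' \<bullet> g + f \<bullet> g' = 0\<close> because \<open>f \<bullet> g\<close> is constant, and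
  \<open>f' \<bullet> g - f \<bullet> g' = 0\<close> because the Wronskian vanishes. So \<open>f'\<close> is orthogonal to every member of a total
  family.
\<close>

lemma frame_constant:
  fixes S :: "(real \<Rightarrow> 'a::real_inner) set"
  assumes I: "open I" "is_interval I"
    and diff: "\<And>f t. f \<in> S \<Longrightarrow> t \<in> I \<Longrightarrow> f differentiable (at t)"
    and gram: "\<And>f g. f \<in> S \<Longrightarrow> g \<in> S \<Longrightarrow> (\<lambda>t. f t \<bullet> g t) constant_on I"
    and wr: "\<And>f g t. f \<in> S \<Longrightarrow> g \<in> S \<Longrightarrow> t \<in> I \<Longrightarrow> wronskian f g t = 0"
    and total: "\<And>t w. t \<in> I \<Longrightarrow> (\<And>f. f \<in> S \<Longrightarrow> w \<bullet> f t = 0) \<Longrightarrow> w = 0"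
    and "f \<in> S"
  shows "f constant_on I"
proof -
  have "(f has_vector_derivative 0) (at t)" if t: "t \<in> I" for t
  proof -
    let ?D = "\<lambda>g. vector_derivative g (at t)"
    have D: "(g has_vector_derivative ?D g) (at t)" if "g \<in> S" for g
      using diff[OF that t] by (simp add: vector_derivative_works)
    have "?D f \<bullet> g t = 0" if g: "g \<in> S" for g
    proof -
      obtain c where c: "\<And>s. s \<in> I \<Longrightarrow> f s \<bullet> g s = c"
        using gram[OF \<open>f \<in> S\<close> g] unfolding constant_on_def by blast
      have "((\<lambda>s. f s \<bullet> g s) has_vector_derivative f t \<bullet> ?D g + ?D f \<bullet> g t) (at t)"
        by (rule bounded_bilinear.has_vector_derivative[OF bounded_bilinear_inner D[OF \<open>f \<in> S\<close>] D[OF g]])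
      moreover have "((\<lambda>s. f s \<bullet> g s) has_vector_derivative 0) (at t)"
        by (rule has_vector_derivative_transform_within_open[where f = "\<lambda>_. c" and S = I])
           (use I t c in auto)
      ultimately have "f t \<bullet> ?D g + ?D f \<bullet> g t = 0"
        by (rule vector_derivative_unique_at)
      moreover have "?D f \<bullet> g t - ?D g \<bullet> f t = 0"
        using wr[OF \<open>f \<in> S\<close> g t] by (simp add: wronskian_def)
      ultimately show ?thesis by (simp add: inner_commute)
    qed
    then have "?D f = 0" by (rule total[OF t])
    then show ?thesis using D[OF \<open>f \<in> S\<close>] by simp
  qed
  then have "\<exists>c. \<forall>t\<in>I. f t = c"
    using has_vector_derivative_zero_constant[of I f] I is_interval_convex
    by (metis has_vector_derivative_at_within)
  then show ?thesis by (auto simp: constant_on_def)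
qed

lemma gram_det_3:
  fixes x y z :: "real^3"
  shows "(det (vector [x, y, z] :: real^3^3))\<^sup>2 =
    (x \<bullet> x) * (y \<bullet> y) * (z \<bullet> z) + 2 * (x \<bullet> y) * (y \<bullet> z) * (x \<bullet> z)
    - (x \<bullet> x) * (y \<bullet> z)\<^sup>2 - (y \<bullet> y) * (x \<bullet> z)\<^sup>2 - (z \<bullet> z) * (x \<bullet> y)\<^sup>2"
  unfolding det_3 inner_vec_def sum_3 vector_3 by (simp add: inner_real_def) algebra

lemma orthogonal_to_basis_3:
  fixes x y z w :: "real^3"
  assumes "det (vector [x, y, z] :: real^3^3) \<noteq> 0" "w \<bullet> x = 0" "w \<bullet> y = 0" "w \<bullet> z = 0"
  shows "w = 0"
proof -
  let ?M = "vector [x, y, z] :: real^3^3"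
  have "?M *v w = 0"
    using assms(2-4)
    by (simp add: vec_eq_iff forall_3 matrix_vector_mult_def vector_3 inner_vec_def mult.commute)
  moreover have "invertible ?M" using assms(1) by (simp add: invertible_det_nz)
  ultimately show ?thesis
    by (metis inj_matrix_vector_mult injD matrix_vector_mult_0_right)
qed

text \<open>
  Multiplying the Gram determinant by \<open>u'\<^sup>3\<close> gives a constant \<open>K\<close> with \<open>u'\<^sup>3 = K u\<^sup>2\<close>, which says that
  the cube root of \<open>u\<close> has constant slope. Rescaling by the cube root makes the frame rigid.
  The point \<open>t0\<close> is the zero of the affine cube root; it lies outside \<open>I\<close> because \<open>u\<close> has no zero there.
\<close>

lemma frame_from_pencil:
  fixes x y z :: "real \<Rightarrow> real^3" and u u' :: "real \<Rightarrow> real"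
  assumes I: "open I" "is_interval I"
    and diff: "\<And>t. t \<in> I \<Longrightarrow> x differentiable (at t)"
      "\<And>t. t \<in> I \<Longrightarrow> y differentiable (at t)" "\<And>t. t \<in> I \<Longrightarrow> z differentiable (at t)"
    and u: "\<And>t. t \<in> I \<Longrightarrow> (u has_real_derivative u' t) (at t)"
    and unz: "\<And>t. t \<in> I \<Longrightarrow> u t \<noteq> 0"
    and nonconst: "\<not> u constant_on I"
    and wr: "\<And>t. t \<in> I \<Longrightarrow> wronskian x y t = 0" "\<And>t. t \<in> I \<Longrightarrow> wronskian x z t = 0"
      "\<And>t. t \<in> I \<Longrightarrow> wronskian y z t = 0"
    and gram: "(\<lambda>t. u' t * (x t \<bullet> x t)) constant_on I" "(\<lambda>t. u' t * (x t \<bullet> y t)) constant_on I"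
      "(\<lambda>t. u' t * (x t \<bullet> z t)) constant_on I" "(\<lambda>t. u' t * (y t \<bullet> y t)) constant_on I"
      "(\<lambda>t. u' t * (y t \<bullet> z t)) constant_on I" "(\<lambda>t. u' t * (z t \<bullet> z t)) constant_on I"
    and det: "\<And>t. t \<in> I \<Longrightarrow> det (vector [x t, y t, z t] :: real^3^3) = 1 / u t"
  obtains t0 \<kappa> e1 e2 e3 where "\<kappa> \<noteq> 0" "t0 \<notin> I"
    "\<And>t. t \<in> I \<Longrightarrow> u t = (\<kappa> * (t - t0))^3"
    "\<And>t. t \<in> I \<Longrightarrow> x t = (1 / (t - t0)) *\<^sub>R e1"
    "\<And>t. t \<in> I \<Longrightarrow> y t = (1 / (t - t0)) *\<^sub>R e2"
    "\<And>t. t \<in> I \<Longrightarrow> z t = (1 / (t - t0)) *\<^sub>R e3"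
proof -
  obtain gxx where gxx: "\<And>t. t \<in> I \<Longrightarrow> u' t * (x t \<bullet> x t) = gxx"
    using gram(1) unfolding constant_on_def by blast
  obtain gxy where gxy: "\<And>t. t \<in> I \<Longrightarrow> u' t * (x t \<bullet> y t) = gxy"
    using gram(2) unfolding constant_on_def by blast
  obtain gxz where gxz: "\<And>t. t \<in> I \<Longrightarrow> u' t * (x t \<bullet> z t) = gxz"
    using gram(3) unfolding constant_on_def by blast
  obtain gyy where gyy: "\<And>t. t \<in> I \<Longrightarrow> u' t * (y t \<bullet> y t) = gyy"
    using gram(4) unfolding constant_on_def by blast
  obtain gyz where gyz: "\<And>t. t \<in> I \<Longrightarrow> u' t * (y t \<bullet> z t) = gyz"
    using gram(5) unfolding constant_on_def by blast
  obtain gzz where gzz: "\<And>t. t \<in> I \<Longrightarrow> u' t * (z t \<bullet> z t) = gzz"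
    using gram(6) unfolding constant_on_def by blast
  define K where "K = gxx * gyy * gzz + 2 * gxy * gyz * gxz - gxx * gyz\<^sup>2 - gyy * gxz\<^sup>2 - gzz * gxy\<^sup>2"
  have K: "u' t ^ 3 = K * (u t)\<^sup>2" if "t \<in> I" for t
  proof -
    have "K = u' t ^ 3 * (det (vector [x t, y t, z t] :: real^3^3))\<^sup>2"
      unfolding K_def gram_det_3 gxx[OF that, symmetric] gxy[OF that, symmetric]
        gxz[OF that, symmetric] gyy[OF that, symmetric] gyz[OF that, symmetric] gzz[OF that, symmetric]
      by (simp add: power2_eq_square power3_eq_cube algebra_simps)
    then show ?thesis
      using det[OF that] unz[OF that] by (simp add: power_divide)
  qed
  define v where "v t = root 3 (u t)" for t
  define \<kappa> where "\<kappa> = root 3 K / 3"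
  have v3: "v t ^ 3 = u t" for t
    by (simp add: v_def odd_real_root_pow)
  have vnz: "v t \<noteq> 0" if "t \<in> I" for t using unz[OF that] v3[of t] by auto
  have u'_eq: "u' t = 3 * \<kappa> * (v t)\<^sup>2" if "t \<in> I" for t
  proof -
    have "u' t = root 3 (u' t ^ 3)" by (simp add: odd_real_root_power_cancel)
    also have "\<dots> = 3 * \<kappa> * (v t)\<^sup>2"
      unfolding K[OF that] by (simp add: \<kappa>_def v_def real_root_mult real_root_power)
    finally show ?thesis .
  qed
  have v': "(v has_real_derivative \<kappa>) (at t)" if "t \<in> I" for t
  proof -
    have "((\<lambda>t. root 3 (u t)) has_real_derivative inverse (3 * root 3 (u t) ^ 2) * u' t) (at t)"
      using DERIV_chain2[OF DERIV_odd_real_root u[OF that], of 3] unz[OF that] by simp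
    then show ?thesis
      using u'_eq[OF that] vnz[OF that] by (simp add: v_def[abs_def] field_simps)
  qed
  have "(\<lambda>t. v t - \<kappa> * t) constant_on I"
    by (rule has_field_derivative_0_imp_constant_on)
      (auto intro!: derivative_eq_intros v' simp: I is_interval_connected)
  then obtain b where b: "\<And>t. t \<in> I \<Longrightarrow> v t = \<kappa> * t + b"
    unfolding constant_on_def by (metis diff_eq_eq add.commute)
  have \<kappa>: "\<kappa> \<noteq> 0"
  proof
    assume "\<kappa> = 0"
    then have "u t = b ^ 3" if "t \<in> I" for t using b[OF that] v3[of t] by simp
    then show False using nonconst by (auto simp: constant_on_def)
  qed
  define t0 where "t0 = - b / \<kappa>"
  have vt: "v t = \<kappa> * (t - t0)" if "t \<in> I" for t
    using b[OF that] \<kappa> by (simp add: t0_def field_simps)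
  have t0: "t0 \<notin> I" using vnz vt by (metis diff_self mult_zero_right)

  define F where "F = (\<lambda>g t. v t *\<^sub>R g t :: real^3)"
  have dF: "F g differentiable (at t)" if "g differentiable (at t)" "t \<in> I" for g t
    unfolding F_def using v'[OF that(2)] that(1)
    by (intro differentiable_scaleR) (auto simp: real_differentiable_def)
  \<comment> \<open>The two terms with \<open>v'\<close> cancel, so rescaling multiplies a Wronskian by \<open>v\<^sup>2\<close>.\<close>
  have wF: "wronskian (F g) (F h) t = (v t)\<^sup>2 * wronskian g h t"
    if "g differentiable (at t)" "h differentiable (at t)" "t \<in> I" for g h t
    unfolding F_def wronskian_scale_left[OF that(1) v'[OF that(3)]]
      wronskian_scale_right[OF that(2) v'[OF that(3)]]
    by (simp add: algebra_simps power2_eq_square)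
  have gF: "(\<lambda>t. F g t \<bullet> F h t) constant_on I"
    if gh: "(\<lambda>t. u' t * (g t \<bullet> h t)) constant_on I" for g h
  proof -
    obtain c where c: "\<And>t. t \<in> I \<Longrightarrow> u' t * (g t \<bullet> h t) = c"
      using gh unfolding constant_on_def by blast
    have "F g t \<bullet> F h t = c / (3 * \<kappa>)" if "t \<in> I" for t
    proof -
      have "3 * \<kappa> * (F g t \<bullet> F h t) = u' t * (g t \<bullet> h t)"
        unfolding u'_eq[OF that] F_def by (simp add: power2_eq_square)
      then show ?thesis unfolding c[OF that] using \<kappa> by (simp add: field_simps)
    qed
    then show ?thesis by (auto simp: constant_on_def)
  qed
  have const: "f constant_on I" if "f \<in> {F x, F y, F z}" for f
  proof (rule frame_constant[OF I _ _ _ _ that])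
    show "f differentiable (at t)" if "f \<in> {F x, F y, F z}" "t \<in> I" for f t
      using that dF diff by auto
    show "(\<lambda>t. f t \<bullet> g t) constant_on I" if "f \<in> {F x, F y, F z}" "g \<in> {F x, F y, F z}" for f g
      using that gF gram by (auto simp: inner_commute)
    show "wronskian f g t = 0" if "f \<in> {F x, F y, F z}" "g \<in> {F x, F y, F z}" "t \<in> I" for f g t
      using that(1,2) by (auto simp: wF diff that(3) wr wronskian_swap[of y x] wronskian_swap[of z x]
        wronskian_swap[of z y])
    show "w = 0" if "t \<in> I" "\<And>f. f \<in> {F x, F y, F z} \<Longrightarrow> w \<bullet> f t = 0" for t w
    proof (rule orthogonal_to_basis_3)
      show "det (vector [x t, y t, z t] :: real^3^3) \<noteq> 0"
        using det[OF that(1)] unz[OF that(1)] by simp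
    qed (use that(2)[of "F x"] that(2)[of "F y"] that(2)[of "F z"] vnz[OF that(1)] in \<open>auto simp: F_def\<close>)
  qed
  have explicit: "\<exists>e. \<forall>t\<in>I. g t = (1 / (t - t0)) *\<^sub>R e" if "g \<in> {x, y, z}" for g
  proof -
    have "F g constant_on I" using const that by auto
    then obtain c where c: "\<And>t. t \<in> I \<Longrightarrow> v t *\<^sub>R g t = c"
      by (auto simp: constant_on_def F_def)
    have "g t = (1 / (t - t0)) *\<^sub>R (1 / \<kappa>) *\<^sub>R c" if "t \<in> I" for t
      using c[OF that, symmetric] vt[OF that] vnz[OF that] by simp
    then show ?thesis by blast
  qed
  obtain e1 where "\<And>t. t \<in> I \<Longrightarrow> x t = (1 / (t - t0)) *\<^sub>R e1" using explicit[of x] by auto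
  moreover obtain e2 where "\<And>t. t \<in> I \<Longrightarrow> y t = (1 / (t - t0)) *\<^sub>R e2" using explicit[of y] by auto
  moreover obtain e3 where "\<And>t. t \<in> I \<Longrightarrow> z t = (1 / (t - t0)) *\<^sub>R e3" using explicit[of z] by auto
  moreover have "u t = (\<kappa> * (t - t0)) ^ 3" if "t \<in> I" for t
    using v3[of t] vt[OF that] by simp
  ultimately show ?thesis using that[OF \<kappa> t0] by blast
qed

section \<open>Constant rotations\<close>

text \<open>
  If \<open>p\<close> times a unit vector is the constant \<open>w\<close>, then \<open>p\<close> is \<open>norm w\<close> or its negative, and it is
  continuous because it is the component of \<open>w\<close> along \<open>r\<close>; so the sign cannot change.
\<close>

lemma unit_factor_constant:
  fixes r :: "real \<Rightarrow> 'a::real_inner"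
  assumes "connected I" "continuous_on I r"
    and unit: "\<And>t. t \<in> I \<Longrightarrow> norm (r t) = 1"
    and pr: "\<And>t. t \<in> I \<Longrightarrow> p t *\<^sub>R r t = w"
    and nz: "\<And>t. t \<in> I \<Longrightarrow> p t \<noteq> 0"
  shows "p constant_on I" and "r constant_on I"
proof -
  show p_const: "p constant_on I"
  proof (rule continuous_finite_range_constant)
    have p: "p t = r t \<bullet> w" if "t \<in> I" for t
      using pr[OF that, symmetric] unit[OF that] by (simp add: norm_eq_1)
    have "continuous_on I (\<lambda>t. r t \<bullet> w)" using assms(2) by (intro continuous_intros)
    then show "continuous_on I p" by (simp add: p cong: continuous_on_cong)
    have "\<bar>p t\<bar> = norm w" if "t \<in> I" for t
      using arg_cong[OF pr[OF that], of norm] unit[OF that] by simp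
    then have "p ` I \<subseteq> {norm w, - norm w}" by force
    then show "finite (p ` I)" by (rule finite_subset) simp
  qed (use assms in auto)
  then obtain c where "\<And>t. t \<in> I \<Longrightarrow> p t = c" unfolding constant_on_def by blast
  then have "r t = (1 / c) *\<^sub>R w" if "t \<in> I" for t
    using that pr[OF that, symmetric] nz[OF that] by simp
  then show "r constant_on I" by (auto simp: constant_on_def)
qed

lemma matrix_vector_mult_vector_3:
  fixes M :: "real^3^'n"
  shows "M *v vector [a, b, c] = a *\<^sub>R column 1 M + b *\<^sub>R column 2 M + c *\<^sub>R column 3 M"
  by (simp add: vec_eq_iff matrix_vector_mult_def sum_3 column_def vector_3)

text \<open>
  A Gram-Schmidt argument with parameters. The first product fixes the direction of the
  first column of \<open>R\<close>. Subtracting that component from the third product fixes the second column, and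
  a rotation maps the cross product of the first two basis vectors to the cross product of
  its first two columns. The entries are then components along these constant vectors.
\<close>

lemma triangular_factorization_constant:
  fixes R :: "real \<Rightarrow> real^3^3" and \<tau> :: "real \<Rightarrow> real"
  assumes I: "connected I" "continuous_on I R"
    and rot: "\<And>t. t \<in> I \<Longrightarrow> rotation_matrix (R t)"
    and \<tau>: "\<And>t. t \<in> I \<Longrightarrow> \<tau> t \<noteq> 0"
    and c2: "\<And>t. t \<in> I \<Longrightarrow> R t *v vector [b12 t, 0, 0] = (1 / \<tau> t) *\<^sub>R e1"
    and c3: "\<And>t. t \<in> I \<Longrightarrow> R t *v vector [b13 t, b23 t, b33 t] = (1 / \<tau> t) *\<^sub>R e2 - (k * (\<tau> t)\<^sup>2) *\<^sub>R e3"
    and c5: "\<And>t. t \<in> I \<Longrightarrow> R t *v vector [b15 t, b25 t, 0] = (\<tau> t)\<^sup>2 *\<^sub>R e3"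
    and nz: "\<And>t. t \<in> I \<Longrightarrow> b12 t \<noteq> 0" "\<And>t. t \<in> I \<Longrightarrow> b25 t \<noteq> 0"
  shows "R constant_on I \<and> (\<exists>k3 k5 k6 k7 k8. \<forall>t\<in>I.
    b15 t = k6 * (\<tau> t)\<^sup>2 \<and> b25 t = k5 * (\<tau> t)\<^sup>2 \<and> b12 t = k3 / \<tau> t \<and>
    b13 t = - k * k6 * (\<tau> t)\<^sup>2 + k7 / \<tau> t \<and> b23 t = - k * k5 * (\<tau> t)\<^sup>2 + k8 / \<tau> t)"
proof -
  let ?r = "\<lambda>i t. column i (R t)"
  have unit: "norm (?r i t) = 1" if "t \<in> I" for i t
    using rot[OF that] by (simp add: rotation_matrix_def orthogonal_matrix_orthonormal_columns)
  have ortho: "?r i t \<bullet> ?r j t = (if i = j then 1 else 0)" if "t \<in> I" for i j t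
    using rot[OF that] unit[OF that, of i]
    by (auto simp: rotation_matrix_def orthogonal_matrix_orthonormal_columns orthogonal_def norm_eq_1)
  have cont: "continuous_on I (?r i)" for i
    unfolding column_def using I(2) by (intro continuous_intros)
  note c2' = c2[unfolded matrix_vector_mult_vector_3, simplified]
  note c3' = c3[unfolded matrix_vector_mult_vector_3, simplified]
  note c5' = c5[unfolded matrix_vector_mult_vector_3, simplified]
  have "(b12 t * \<tau> t) *\<^sub>R ?r 1 t = e1" if "t \<in> I" for t
    using arg_cong[OF c2'[OF that], of "\<lambda>w. \<tau> t *\<^sub>R w"] \<tau>[OF that] by (simp add: mult.commute)
  note r1 = unit_factor_constant[OF I(1) cont unit this]
  obtain k3 where k3: "\<And>t. t \<in> I \<Longrightarrow> b12 t * \<tau> t = k3"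
    using r1(1) nz \<tau> by (auto simp: constant_on_def)
  obtain \<rho>1 where \<rho>1: "\<And>t. t \<in> I \<Longrightarrow> ?r 1 t = \<rho>1"
    using r1(2) nz \<tau> by (auto simp: constant_on_def)
  define k6 where "k6 = \<rho>1 \<bullet> e3"
  have b15: "b15 t = k6 * (\<tau> t)\<^sup>2" if "t \<in> I" for t
    using arg_cong[OF c5'[OF that], of "\<lambda>w. ?r 1 t \<bullet> w"] ortho[OF that]
    by (simp add: inner_add_right k6_def \<rho>1[OF that, symmetric] mult.commute)
  have "(b25 t / (\<tau> t)\<^sup>2) *\<^sub>R ?r 2 t = e3 - k6 *\<^sub>R \<rho>1" if "t \<in> I" for t
  proof -
    have "b25 t *\<^sub>R ?r 2 t = (\<tau> t)\<^sup>2 *\<^sub>R (e3 - k6 *\<^sub>R \<rho>1)"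
      using c5'[OF that] b15[OF that] \<rho>1[OF that] by (simp add: algebra_simps)
    from arg_cong[OF this, of "\<lambda>w. (1 / (\<tau> t)\<^sup>2) *\<^sub>R w"] show ?thesis using \<tau>[OF that] by simp
  qed
  note r2 = unit_factor_constant[OF I(1) cont unit this]
  obtain k5 where k5: "\<And>t. t \<in> I \<Longrightarrow> b25 t / (\<tau> t)\<^sup>2 = k5"
    using r2(1) nz \<tau> by (auto simp: constant_on_def)
  obtain \<rho>2 where \<rho>2: "\<And>t. t \<in> I \<Longrightarrow> ?r 2 t = \<rho>2"
    using r2(2) nz \<tau> by (auto simp: constant_on_def)
  have r3: "?r 3 t = cross3 \<rho>1 \<rho>2" if "t \<in> I" for t
    using cross_rotation_matrix[OF rot[OF that], of "axis 1 1" "axis 2 1"] \<rho>1[OF that] \<rho>2[OF that]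
    by (simp add: cross_basis matrix_vector_mult_basis)
  have "R s = R t" if "s \<in> I" "t \<in> I" for s t
  proof -
    have "column i (R s) = column i (R t)" for i
      using exhaust_3[of i] that \<rho>1 \<rho>2 r3 by auto
    then show ?thesis by (simp add: vec_eq_iff column_def)
  qed
  then have Rc: "R constant_on I" unfolding constant_on_def by blast
  have b25: "b25 t = k5 * (\<tau> t)\<^sup>2" if "t \<in> I" for t
    using k5[OF that] \<tau>[OF that] by auto
  have "b13 t = (\<rho>1 \<bullet> e2) / \<tau> t - k * b15 t \<and> b23 t = (\<rho>2 \<bullet> e2) / \<tau> t - k * b25 t" if "t \<in> I" for t
  proof -
    have "?r 1 t \<bullet> ((\<tau> t)\<^sup>2 *\<^sub>R e3) = b15 t" "?r 2 t \<bullet> ((\<tau> t)\<^sup>2 *\<^sub>R e3) = b25 t"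
      unfolding c5'[OF that, symmetric] using ortho[OF that] by (simp_all add: inner_add_right)
    then show ?thesis
      using arg_cong[OF c3'[OF that], of "\<lambda>w. ?r 1 t \<bullet> w"] arg_cong[OF c3'[OF that], of "\<lambda>w. ?r 2 t \<bullet> w"]
        ortho[OF that]
      by (simp add: inner_add_right inner_diff_right \<rho>1[OF that, symmetric] \<rho>2[OF that, symmetric] mult.assoc)
  qed
  then have "\<forall>t\<in>I. b15 t = k6 * (\<tau> t)\<^sup>2 \<and> b25 t = k5 * (\<tau> t)\<^sup>2 \<and> b12 t = k3 / \<tau> t \<and>
    b13 t = - k * k6 * (\<tau> t)\<^sup>2 + (\<rho>1 \<bullet> e2) / \<tau> t \<and> b23 t = - k * k5 * (\<tau> t)\<^sup>2 + (\<rho>2 \<bullet> e2) / \<tau> t"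
    using b15 b25 k3 \<tau> by (auto simp: eq_divide_eq)
  with Rc show ?thesis by blast
qed

section \<open>The columns of \<open>A\<close>\<close>

text \<open>
  In the index type \<open>6\<close> the numeral \<open>6\<close> is \<open>0\<close>; the sixth entry of a list is still found at that index,
  since \<open>vector\<close> counts up from \<open>1\<close> and wraps around.
\<close>

lemma vector_6:
  fixes x1 :: "'a::zero"
  shows "(vector [x1,x2,x3,x4,x5,x6] :: 'a^6) $ 1 = x1"
   "(vector [x1,x2,x3,x4,x5,x6] :: 'a^6) $ 2 = x2"
   "(vector [x1,x2,x3,x4,x5,x6] :: 'a^6) $ 3 = x3"
   "(vector [x1,x2,x3,x4,x5,x6] :: 'a^6) $ 4 = x4"
   "(vector [x1,x2,x3,x4,x5,x6] :: 'a^6) $ 5 = x5"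
   "(vector [x1,x2,x3,x4,x5,x6] :: 'a^6) $ 6 = x6"
  unfolding vector_def by simp_all

lemma B_mat_columns:
  fixes l1 l2 b12 b13 b15 b23 b25 :: real
  defines "B \<equiv> B_mat l1 l2 b12 b13 b15 b23 b25"
  shows "column 1 B = l1 *\<^sub>R column 2 B"
    and "column 2 B = vector [b12, 0, 0]"
    and "column 3 B = vector [b13, b23, - 1 / (b12 * b25)]"
    and "column 4 B = l2 *\<^sub>R column 5 B"
    and "column 5 B = vector [b15, b25, 0]"
    and "column 6 B = (1 / l2) *\<^sub>R column 3 B + l1 *\<^sub>R column 5 B"
  by (simp_all add: B_def B_mat_def column_def vec_eq_iff forall_3 vector_3 vector_6)

lemma column_matrix_mult: "column j (M ** N) = M *v column j N"
  by (simp add: vec_eq_iff column_def matrix_matrix_mult_def matrix_vector_mult_def)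

lemma det_rows_matrix_vector_mult:
  fixes M :: "real^3^3"
  shows "det (vector [M *v p, M *v q, M *v w] :: real^3^3) = det M * det (vector [p, q, w] :: real^3^3)"
proof -
  have "(vector [M *v p, M *v q, M *v w] :: real^3^3) = vector [p, q, w] ** transpose M"
    by (simp add: vec_eq_iff forall_3 matrix_vector_mult_def matrix_matrix_mult_def transpose_def
        sum_3 vector_3 mult.commute)
  then show ?thesis by (simp add: det_mul)
qed

lemma columns_independent_not_proportional:
  assumes "columns_independent_on I A" "i \<noteq> j"
  shows "\<exists>t\<in>I. column i (A t) \<noteq> c *\<^sub>R column j (A t)"
proof (rule ccontr)
  assume "\<not> ?thesis"
  then have eq: "\<And>t. t \<in> I \<Longrightarrow> column i (A t) = c *\<^sub>R column j (A t)" by blast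
  let ?c = "\<lambda>k. (if k = i then 1 else 0) - (if k = j then c else 0)"
  have "(\<Sum>k\<in>UNIV. ?c k *\<^sub>R column k (A t)) = 0" if "t \<in> I" for t
    by (simp add: scaleR_diff_left sum_subtractf if_distrib[of "\<lambda>a. a *\<^sub>R _"] eq[OF that] cong: if_cong)
  then have "?c i = 0"
    using assms(1)[unfolded columns_independent_on_def, rule_format, of ?c i] by blast
  then show False using assms(2) by simp
qed

theorem lemma8p3:
  fixes I :: "real set"
    and A :: "real \<Rightarrow> real^6^3"
    and R :: "real \<Rightarrow> real^3^3"
    and l1 l2 b12 b13 b15 b23 b25 :: "real \<Rightarrow> real"
    and k0 k1 k2 :: real
  assumes "open I" and "is_interval I"
    and "smooth_on_open I A"
    and "columns_independent_on I A"
    and "\<And>t. t \<in> I \<Longrightarrow> rotation_matrix (R t)"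
    and "continuous_on I R"
    and "\<And>t. t \<in> I \<Longrightarrow>
           A t = R t ** B_mat (l1 t) (l2 t) (b12 t) (b13 t) (b15 t) (b23 t) (b25 t)"
    and "\<And>t. t \<in> I \<Longrightarrow> b12 t \<noteq> 0"
    and "\<And>t. t \<in> I \<Longrightarrow> b25 t \<noteq> 0"
    and "\<And>t. t \<in> I \<Longrightarrow> l2 t \<noteq> 0"
    and "Q A 1 2 constant_on I" and "Q A 1 3 constant_on I" and "Q A 1 4 constant_on I"
    and "Q A 2 5 constant_on I" and "Q A 2 3 constant_on I" and "Q A 2 4 constant_on I"
    and "Q A 3 5 constant_on I" and "Q A 3 6 constant_on I"
    and "Q A 4 5 constant_on I" and "Q A 4 6 constant_on I"
    and "Q A 5 6 constant_on I"
    and "(\<lambda>t. Q A 1 5 t - Q A 2 6 t) constant_on I"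
    and "\<And>t. t \<in> I \<Longrightarrow> l1 t = k2 * l2 t + k1 + k0 / l2 t"
    and "k2 = 0"
  shows "R constant_on I \<and>
    (\<exists>t0 k3 k4 k5 k6 k7 k8 :: real. t0 \<notin> I \<and> k4 \<noteq> 0 \<and>
       (\<forall>t\<in>I.
          l1 t = k1 + k0 * (t - t0)^3 / k4 \<and>
          l2 t = k4 / (t - t0)^3 \<and>
          b15 t = k6 * (t - t0)^2 \<and>
          b25 t = k5 * (t - t0)^2 \<and>
          b12 t = k3 / (t - t0) \<and>
          b13 t = - k0 * k6 * (t - t0)^2 + k7 / (t - t0) \<and>
          b23 t = - k0 * k5 * (t - t0)^2 + k8 / (t - t0)))"
proof -
  define a where "a i t = column i (A t)" for i t
  define u where "u t = 1 / l2 t" for t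
  define x where "x = a 2"
  define y where "y t = a 3 t + k0 *\<^sub>R a 5 t" for t
  define z where "z = a 4"
  note B = assms(7)
  note nz = assms(8,9,10)
  have conn: "connected I" using assms(2) by (simp add: is_interval_connected)
  have col: "a j t = R t *v column j (B_mat (l1 t) (l2 t) (b12 t) (b13 t) (b15 t) (b23 t) (b25 t))"
    if "t \<in> I" for j t
    by (simp add: a_def B[OF that] column_matrix_mult)
  have a2: "a 2 t = R t *v vector [b12 t, 0, 0]"
    and a3: "a 3 t = R t *v vector [b13 t, b23 t, - 1 / (b12 t * b25 t)]"
    and a5: "a 5 t = R t *v vector [b15 t, b25 t, 0]" if "t \<in> I" for t
    unfolding col[OF that] B_mat_columns by (rule refl)+
  have a1: "a 1 t = l1 t *\<^sub>R a 2 t" and a4: "a 4 t = l2 t *\<^sub>R a 5 t"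
    and a6: "a 6 t = u t *\<^sub>R a 3 t + l1 t *\<^sub>R a 5 t" if "t \<in> I" for t
    unfolding col[OF that] B_mat_columns(1,4,6) u_def
    by (simp_all add: matrix_vector_right_distrib matrix_vector_mult_scaleR)
  have l1: "l1 t = k1 + k0 * u t" if "t \<in> I" for t
    using assms(23)[OF that] assms(24) by (simp add: u_def)
  have unz: "u t \<noteq> 0" if "t \<in> I" for t using nz(3)[OF that] by (simp add: u_def)

  have diff: "a j differentiable (at t)" if "t \<in> I" for j t
  proof -
    have "A differentiable (at t)"
      using assms(3)[unfolded smooth_on_open_def, rule_format, of t 0] that by simp
    moreover have "bounded_linear (\<lambda>M::real^6^3. column j M)"
      by (intro linear_conv_bounded_linear[THEN iffD1] linearI) (simp_all add: column_def vec_eq_iff)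
    ultimately show ?thesis
      unfolding a_def[abs_def] differentiable_def using bounded_linear.has_derivative by blast
  qed

  have c1: "a 1 t = (k1 + k0 * u t) *\<^sub>R x t"
    and c5: "a 5 t = u t *\<^sub>R z t"
    and c3: "a 3 t = y t - (k0 * u t) *\<^sub>R z t"
    and c6: "a 6 t = u t *\<^sub>R y t + (k1 * u t) *\<^sub>R z t" if "t \<in> I" for t
  proof -
    show "a 1 t = (k1 + k0 * u t) *\<^sub>R x t" by (simp add: a1[OF that] l1[OF that] x_def)
    show h5: "a 5 t = u t *\<^sub>R z t" by (simp add: z_def a4[OF that] u_def nz(3)[OF that])
    then have h5': "k *\<^sub>R a 5 t = (k * u t) *\<^sub>R z t" for k by simp
    show "a 3 t = y t - (k0 * u t) *\<^sub>R z t" by (simp add: y_def h5')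
    show "a 6 t = u t *\<^sub>R y t + (k1 * u t) *\<^sub>R z t"
      unfolding a6[OF that] y_def l1[OF that] h5' scaleR_add_right scaleR_scaleR scaleR_add_left[symmetric]
        add.assoc by (simp add: algebra_simps)
  qed

  have z0: "z t \<noteq> 0" if "t \<in> I" for t
  proof
    assume "z t = 0"
    then have "R t *v vector [b15 t, b25 t, 0] = 0"
      using c5[OF that] a5[OF that] by simp
    moreover have "orthogonal_transformation ((*v) (R t))"
      using assms(5)[OF that] by (simp add: rotation_matrix_def orthogonal_transformation_matrix)
    ultimately have "(vector [b15 t, b25 t, 0] :: real^3) = 0"
      using orthogonal_transformation_norm[of "(*v) (R t)" "vector [b15 t, b25 t, 0]"] by simp
    then have "(vector [b15 t, b25 t, 0] :: real^3) $ 2 = 0" by simp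
    then show False using nz(2)[OF that] by (simp add: vector_3)
  qed
  \<comment> \<open>Only \<open>A\<close> is known to be smooth, but \<open>u\<close> is a quotient of inner products of columns.\<close>
  have u': "(u has_real_derivative deriv u t) (at t)" if "t \<in> I" for t
  proof -
    have u_eq: "(a 5 s \<bullet> z s) / (z s \<bullet> z s) = u s" if "s \<in> I" for s
      using c5[OF that] z0[OF that] by simp
    have "(\<lambda>s. (a 5 s \<bullet> z s) / (z s \<bullet> z s)) differentiable (at t)"
      using diff[OF that] z0[OF that] unfolding z_def by (intro differentiable_divide differentiable_inner) auto
    then obtain D where "((\<lambda>s. (a 5 s \<bullet> z s) / (z s \<bullet> z s)) has_real_derivative D) (at t)"
      by (auto simp: real_differentiable_def)
    then have "(u has_real_derivative D) (at t)"
      by (rule has_field_derivative_transform_within_open[OF _ assms(1) that u_eq])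
    then show ?thesis using DERIV_imp_deriv[of u D t] by simp
  qed
  have u_nonconst: "\<not> u constant_on I"
  proof
    assume "u constant_on I"
    then obtain c where "\<And>t. t \<in> I \<Longrightarrow> u t = c" unfolding constant_on_def by blast
    then have "a 5 t = c *\<^sub>R a 4 t" if "t \<in> I" for t
      using c5[OF that] that by (simp add: z_def)
    moreover have "(5::6) \<noteq> 4" by simp
    ultimately show False
      using columns_independent_not_proportional[OF assms(4), of 5 4 c] unfolding a_def by blast
  qed
  have k0: "k0 \<noteq> 0"
  proof
    assume "k0 = 0"
    then have "a 1 t = k1 *\<^sub>R a 2 t" if "t \<in> I" for t
      using c1[OF that] by (simp add: x_def)
    moreover have "(1::6) \<noteq> 2" by simp
    ultimately show False
      using columns_independent_not_proportional[OF assms(4), of 1 2 k1] unfolding a_def by blast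
  qed
  have xyz: "x differentiable (at t)" "y differentiable (at t)" "z differentiable (at t)"
    if "t \<in> I" for t
    unfolding x_def y_def[abs_def] z_def
    by (intro differentiable_add differentiable_scaleR differentiable_const diff[OF that])+

  have QW: "Q A i j t = wronskian f g t"
    if "t \<in> I" "\<And>s. s \<in> I \<Longrightarrow> a i s = f s" "\<And>s. s \<in> I \<Longrightarrow> a j s = g s" for i j f g t
    using wronskian_cong[OF assms(1) that] by (simp add: Q_def wronskian_def a_def[abs_def])
  have QC: "wronskian f g constant_on I"
    if "Q A i j constant_on I" "\<And>s. s \<in> I \<Longrightarrow> a i s = f s" "\<And>s. s \<in> I \<Longrightarrow> a j s = g s" for i j f g
    using that(1) QW[OF _ that(2,3)] by (auto simp: constant_on_def)
  have c2: "\<And>t. t \<in> I \<Longrightarrow> a 2 t = x t" and c4: "\<And>t. t \<in> I \<Longrightarrow> a 4 t = z t"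
    by (simp_all add: x_def z_def)
  have q1526: "(\<lambda>t. wronskian (\<lambda>t. (k1 + k0 * u t) *\<^sub>R x t) (\<lambda>t. u t *\<^sub>R z t) t
      - wronskian x (\<lambda>t. u t *\<^sub>R y t + (k1 * u t) *\<^sub>R z t) t) constant_on I"
    using assms(22) QW[OF _ c1 c5] QW[OF _ c2 c6] by (auto simp: constant_on_def)
  note pencil = pencil_relations[OF xyz u' unz u_nonconst k0
      QC[OF assms(11) c1 c2] QC[OF assms(12) c1 c3] QC[OF assms(13) c1 c4]
      QC[OF assms(14) c2 c5] QC[OF assms(15) c2 c3] QC[OF assms(16) c2 c4]
      QC[OF assms(17) c3 c5] QC[OF assms(18) c3 c6] QC[OF assms(19) c4 c5]
      QC[OF assms(20) c4 c6] QC[OF assms(21) c5 c6] q1526]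
  have wr: "wronskian x y t = 0" "wronskian x z t = 0" "wronskian y z t = 0" if "t \<in> I" for t
    by (rule pencil; (assumption | rule that))+
  have gram:
    "(\<lambda>t. deriv u t * (x t \<bullet> x t)) constant_on I" "(\<lambda>t. deriv u t * (x t \<bullet> y t)) constant_on I"
    "(\<lambda>t. deriv u t * (x t \<bullet> z t)) constant_on I" "(\<lambda>t. deriv u t * (y t \<bullet> y t)) constant_on I"
    "(\<lambda>t. deriv u t * (y t \<bullet> z t)) constant_on I" "(\<lambda>t. deriv u t * (z t \<bullet> z t)) constant_on I"
    by (rule pencil; assumption)+
  have det: "det (vector [x t, y t, z t] :: real^3^3) = 1 / u t" if "t \<in> I" for t
  proof -
    let ?p = "vector [b12 t, 0, 0] :: real^3"
    let ?q = "vector [b13 t, b23 t, - 1 / (b12 t * b25 t)] + k0 *\<^sub>R vector [b15 t, b25 t, 0] :: real^3"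
    let ?w = "l2 t *\<^sub>R vector [b15 t, b25 t, 0] :: real^3"
    have "x t = R t *v ?p" "y t = R t *v ?q" "z t = R t *v ?w"
      by (simp_all add: x_def y_def z_def a2[OF that] a3[OF that] a4[OF that] a5[OF that]
          matrix_vector_right_distrib matrix_vector_mult_scaleR)
    then have "det (vector [x t, y t, z t] :: real^3^3) = det (vector [?p, ?q, ?w] :: real^3^3)"
      using assms(5)[OF that] by (simp add: det_rows_matrix_vector_mult rotation_matrix_def)
    also have "\<dots> = l2 t"
      using nz[OF that] by (simp add: det_3 vector_3)
    finally show ?thesis by (simp add: u_def)
  qed
  obtain t0 \<kappa> e1 e2 e3 where \<kappa>: "\<kappa> \<noteq> 0" and t0: "t0 \<notin> I"
    and ut: "\<And>t. t \<in> I \<Longrightarrow> u t = (\<kappa> * (t - t0))^3"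
    and x_eq: "\<And>t. t \<in> I \<Longrightarrow> x t = (1 / (t - t0)) *\<^sub>R e1"
    and y_eq: "\<And>t. t \<in> I \<Longrightarrow> y t = (1 / (t - t0)) *\<^sub>R e2"
    and z_eq: "\<And>t. t \<in> I \<Longrightarrow> z t = (1 / (t - t0)) *\<^sub>R e3"
    by (rule frame_from_pencil[OF assms(1,2) xyz u' unz u_nonconst wr gram det])
      (assumption | blast intro: that)+
  have \<tau>: "t - t0 \<noteq> 0" if "t \<in> I" for t using t0 that by auto
  have a5': "a 5 t = (t - t0)\<^sup>2 *\<^sub>R (\<kappa>^3 *\<^sub>R e3)" if "t \<in> I" for t
    using \<tau>[OF that] by (simp add: c5[OF that] ut[OF that] z_eq[OF that] power_mult_distrib
        power2_eq_square power3_eq_cube)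
  have tri: "R constant_on I \<and> (\<exists>k3 k5 k6 k7 k8. \<forall>t\<in>I.
    b15 t = k6 * (t - t0)\<^sup>2 \<and> b25 t = k5 * (t - t0)\<^sup>2 \<and> b12 t = k3 / (t - t0) \<and>
    b13 t = - k0 * k6 * (t - t0)\<^sup>2 + k7 / (t - t0) \<and> b23 t = - k0 * k5 * (t - t0)\<^sup>2 + k8 / (t - t0))"
  proof (rule triangular_factorization_constant[OF conn assms(6,5) \<tau> _ _ _ nz(1,2)])
    show "R t *v vector [b12 t, 0, 0] = (1 / (t - t0)) *\<^sub>R e1" if "t \<in> I" for t
      using a2[OF that] x_eq[OF that] by (simp add: x_def)
    show "R t *v vector [b13 t, b23 t, - 1 / (b12 t * b25 t)]
        = (1 / (t - t0)) *\<^sub>R e2 - (k0 * (t - t0)\<^sup>2) *\<^sub>R (\<kappa>^3 *\<^sub>R e3)" if "t \<in> I" for t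
    proof -
      have "a 3 t = y t - k0 *\<^sub>R a 5 t" by (simp add: y_def)
      then show ?thesis unfolding a3[OF that, symmetric] a5'[OF that] y_eq[OF that] by simp
    qed
    show "R t *v vector [b15 t, b25 t, 0] = (t - t0)\<^sup>2 *\<^sub>R (\<kappa>^3 *\<^sub>R e3)" if "t \<in> I" for t
      using a5[OF that] a5'[OF that] by simp
  qed
  define k4 where "k4 = 1 / \<kappa>^3"
  have l12: "l1 t = k1 + k0 * (t - t0)^3 / k4" "l2 t = k4 / (t - t0)^3" if "t \<in> I" for t
  proof -
    have "u t = (t - t0)^3 / k4" by (simp add: ut[OF that] k4_def power_mult_distrib)
    moreover have "l2 t = 1 / u t" by (simp add: u_def)
    ultimately show "l1 t = k1 + k0 * (t - t0)^3 / k4" "l2 t = k4 / (t - t0)^3"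
      using \<kappa> l1[OF that] by (simp_all add: k4_def)
  qed
  have "k4 \<noteq> 0" using \<kappa> by (simp add: k4_def)
  from tri obtain k3 k5 k6 k7 k8 where "\<forall>t\<in>I.
    b15 t = k6 * (t - t0)\<^sup>2 \<and> b25 t = k5 * (t - t0)\<^sup>2 \<and> b12 t = k3 / (t - t0) \<and>
    b13 t = - k0 * k6 * (t - t0)\<^sup>2 + k7 / (t - t0) \<and> b23 t = - k0 * k5 * (t - t0)\<^sup>2 + k8 / (t - t0)"
    by blast
  with l12 \<open>k4 \<noteq> 0\<close> t0 have "t0 \<notin> I \<and> k4 \<noteq> 0 \<and> (\<forall>t\<in>I.
    l1 t = k1 + k0 * (t - t0)^3 / k4 \<and> l2 t = k4 / (t - t0)^3 \<and>
    b15 t = k6 * (t - t0)\<^sup>2 \<and> b25 t = k5 * (t - t0)\<^sup>2 \<and> b12 t = k3 / (t - t0) \<and>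
    b13 t = - k0 * k6 * (t - t0)\<^sup>2 + k7 / (t - t0) \<and> b23 t = - k0 * k5 * (t - t0)\<^sup>2 + k8 / (t - t0))"
    by blast
  then show ?thesis using tri by blast
qed

end
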